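(* Let $k\geq 2$ be an even integer or $k=1$, and let $g$ be an even permutation with support size $s$. Then there is a Stirling function $(n,m)\mapsto\big[{n\atop m}\big]_{g}$ with threshold $t=\max\{s,4k\}$ such that $$\Phi(\Gamma^{k}_{n};\,r,g)=\Big[{n\atop n-rk}\Big]_{g}$$ for all $n>t$ and all $r\geq 3$; when $k=1$ the equality holds for all $n>t$ and all $r\geq 0$.
   Context: For an integer $t\geq 0$ let $\mathbb{N}_t=\{n\in\mathbb{Z}: n\geq t\}$. A function $\mathbb{N}_t\times\mathbb{Z}\to\mathbb{N}_0$, $(n,m)\mapsto\big[{n\atop m}\big]$, is a Stirling function with threshold $t$ if for all $n>t$ and all $m\in\mathbb{Z}$ it satisfies $\big[{n\atop m}\big]=\big[{n-1\atop m-1}\big]+(n-1)\big[{n-1\atop m}\big]$, and $\big[{n\atop m}\big]=0$ whenever $m>n$. (The values at $n=t$ are the arbitrary initial values.) For $k\geq 1$ and $n\geq 2k$, a $k$-transposition in $\mathrm{Sym}(n)$ is a permutation of cycle shape $(a_1\,b_1)\cdots(a_k\,b_k)$, i.e. a product of $k$ pairwise disjoint transpositions. Let $H$ be the set of all $k$-transpositions in $\mathrm{Sym}(n)$. It generates $G=\mathrm{Sym}(n)$ if $k$ is odd and $G=\mathrm{Alt}(n)$ if $k$ is even and $n\neq 4$. The $k$-transposition Cayley graph $\Gamma^k_n$ has vertex set $G$, with $u\neq v$ joined by an edge if and only if $v=uh$ for some $h\in H$. Let $\mathrm{d}$ be its graph distance and let $B_r(\Gamma^k_n,g)=\{u\in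 G:\mathrm{d}(g,u)\leq r\}$. The metric intersection numbers are $\Phi(\Gamma^k_n;\,r,g)=|B_r(\Gamma^k_n,e)\cap B_r(\Gamma^k_n,g)|$, where $e$ is the identity. The support size of a permutation $g$ of some finite set is the number of elements moved by $g$. A permutation $g$ with support size $s$ is viewed as an element of $\mathrm{Sym}(n)$ for every $n\geq s$, by identifying the moved set with a subset of $\{1,\dots,n\}$; the value $\Phi(\Gamma^k_n;\,r,g)$ does not depend on the identification. *)

theory Defs
  imports
    "HOL-Combinatorics.Permutations"
    "HOL-Algebra.Sym_Groups"
    "HOL-Algebra.Generated_Groups"
    "Graph_Theory.Pair_Digraph"
    "Graph_Theory.Shortest_Path"
begin

definition stirling_function :: "nat \<Rightarrow> (nat \<Rightarrow> int \<Rightarrow> nat) \<Rightarrow> bool" where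
  (* S is a total function, but only its values S n m with n \<ge> t are constrained. *)
  "stirling_function t S \<longleftrightarrow>
     (\<forall>n>t. \<forall>m. S n m = S (n - 1) (m - 1) + (n - 1) * S (n - 1) m) \<and>
     (\<forall>n\<ge>t. \<forall>m>int n. S n m = 0)"

definition k_transpositions :: "nat \<Rightarrow> nat \<Rightarrow> (nat \<Rightarrow> nat) set" where
  "k_transpositions k n =
     {foldr (\<lambda>(a, b) p. transpose a b \<circ> p) ts id | ts.
        length ts = k \<and> distinct (map fst ts @ map snd ts) \<and>
        set (map fst ts @ map snd ts) \<subseteq> {1..n}}"

(* Undirected graphs are encoded as digraphs; for H closed under inverses the
   arc relation below is symmetric. *)
definition cayley_graph :: "('a, 'b) monoid_scheme \<Rightarrow> 'a set \<Rightarrow> 'a pair_pre_digraph" where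
  "cayley_graph G H =
     \<lparr> pverts = generate G H,
       parcs = {(u, v). u \<in> generate G H \<and> v \<in> generate G H \<and> u \<noteq> v \<and>
                        (\<exists>h\<in>H. v = u \<otimes>\<^bsub>G\<^esub> h)} \<rparr>"

lemma wf_digraph_cayley_graph: "wf_digraph (with_proj (cayley_graph G H))"
  by unfold_locales (auto simp: cayley_graph_def with_proj_def)

(* With all arc weights 1 the weight of a walk is its length; the distance between
   vertices in different components is \<infinity>. *)
definition graph_dist :: "'a pair_pre_digraph \<Rightarrow> 'a \<Rightarrow> 'a \<Rightarrow> ereal" where
  "graph_dist \<Gamma> u v = wf_digraph.\<mu> (with_proj \<Gamma>) (\<lambda>_. 1) u v"

definition graph_ball :: "'a pair_pre_digraph \<Rightarrow> nat \<Rightarrow> 'a \<Rightarrow> 'a set" where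
  "graph_ball \<Gamma> r g = {u \<in> pverts \<Gamma>. graph_dist \<Gamma> g u \<le> ereal (real r)}"

(* The vertex set is the subgroup of Sym(n) generated by the k-transpositions. *)
definition transposition_cayley_graph :: "nat \<Rightarrow> nat \<Rightarrow> (nat \<Rightarrow> nat) pair_pre_digraph" where
  "transposition_cayley_graph k n = cayley_graph (sym_group n) (k_transpositions k n)"

definition metric_intersection_number :: "nat \<Rightarrow> nat \<Rightarrow> nat \<Rightarrow> (nat \<Rightarrow> nat) \<Rightarrow> nat" where
  "metric_intersection_number k n r g =
     card (graph_ball (transposition_cayley_graph k n) r id \<inter>
           graph_ball (transposition_cayley_graph k n) r g)"

definition moved :: "('a \<Rightarrow> 'a) \<Rightarrow> 'a set" where
  "moved g = {x. g x \<noteq> x}"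

(* The copies of g in Sym(n): one for each injection of the moved points into {1..n}.
   map_permutation A f g acts as f \<circ> g \<circ> f^-1 on f ` A and fixes all other points. *)
definition copies_in_Sym :: "nat \<Rightarrow> ('a \<Rightarrow> 'a) \<Rightarrow> (nat \<Rightarrow> nat) set" where
  "copies_in_Sym n g =
     {map_permutation (moved g) f g | f. inj_on f (moved g) \<and> f ` moved g \<subseteq> {1..n}}"

end

theory Submission
  imports Defs "HOL-Combinatorics.Cycles"
begin

text \<open>
  Write \<open>|u|\<close> for the least number of transpositions whose product is \<open>u\<close> (the constant
  \<open>transposition_length\<close>). The statement follows from two facts.

  First, the balls of the graph are determined by \<open>|u|\<close> and the parity of \<open>u\<close>: for \<open>n \<ge> 4 k\<close> and
  \<open>r \<ge> 2\<close> (any \<open>r\<close> if \<open>k = 1\<close>), the ball of radius \<open>r\<close> around the identity consists of the permutations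
  with \<open>|u| \<le> r k\<close>, only the even ones if \<open>k\<close> is even. One inclusion is clear. For the other,
  every cycle is a product of two reflections, and hence every \<open>u\<close> is a product of two involutions with \<open>|u|\<close> transpositions in
  total, distributed as evenly as the parity of \<open>|u|\<close> allows (\<open>balanced_factorisation\<close>). If \<open>u\<close> is even
  and \<open>|u| \<le> 2 k\<close>, the two involutions become \<open>k\<close>-transpositions after padding both with the same
  transpositions of points that neither moves (\<open>product_of_two_k_transpositions\<close>). If \<open>|u| \<ge> 2 k\<close>, then
  \<open>k\<close> transpositions of one involution can be split off, which shortens \<open>u\<close> by \<open>k\<close>
  (\<open>k_transposition_shortens\<close>). Induction on \<open>r\<close> gives \<open>word_products_eq\<close>. As the ball around \<open>g\<close>
  is the translate of the ball around the identity, the intersection number counts the \<open>u\<close> with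
  \<open>|u| \<le> d\<close> and \<open>|g\<inverse> u| \<le> d\<close> at \<open>d = r k\<close>, with a parity condition if \<open>k\<close> is even.

  Second, for a fixed \<open>g\<close> these counts, with \<open>d = n - m\<close>, satisfy the Stirling recurrence
  (\<open>card_ball_intersection_step\<close>). The reason is the one for the classical Stirling numbers
  of the first kind: a new point is either fixed, or it is inserted into a cycle next to one of the
  old points. Because \<open>g\<close> fixes the new point, the insertion raises both \<open>|u|\<close> and \<open>|g\<inverse> u|\<close> by one.

  Finally, the counts do not change if \<open>g\<close> is replaced by a conjugate, so a single copy of \<open>g\<close> on the
  points \<open>{1..s}\<close> defines the Stirling function for all \<open>n\<close>.
\<close>

section \<open>The transposition length of a permutation\<close>

text \<open>For a permutation of a finite set of size \<open>n\<close> this is \<open>n\<close> minus the number of cycles. The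
  definition through factorisations is preferred because it makes no reference to the ambient set:
  the length stays the same when the permutation is regarded as one of a larger set.\<close>

definition transposition_length :: "('a \<Rightarrow> 'a) \<Rightarrow> nat" where
  "transposition_length p = (LEAST l. swapidseq l p)"

lemma swapidseq_transposition_length:
  "permutation p \<Longrightarrow> swapidseq (transposition_length p) p"
  unfolding transposition_length_def permutation_def by (rule LeastI_ex)

lemma transposition_length_le: "swapidseq l p \<Longrightarrow> transposition_length p \<le> l"
  unfolding transposition_length_def by (rule Least_le)

lemma transposition_length_id [simp]: "transposition_length id = 0"
  using transposition_length_le[of 0 id] by simp

lemma transposition_length_comp_le:
  assumes "permutation p" "permutation q"
  shows "transposition_length (p \<circ> q) \<le> transposition_length p + transposition_length q"
  using assms by (intro transposition_length_le swapidseq_comp_add swapidseq_transposition_length)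

lemma evenperm_iff_even_transposition_length:
  "permutation p \<Longrightarrow> evenperm p \<longleftrightarrow> even (transposition_length p)"
  using evenperm_unique swapidseq_transposition_length by blast

text \<open>The transposition merges the fixed point \<open>a\<close> into the cycle of \<open>b\<close>. Both the Stirling
  recurrence and the value of the length on a cycle rest on this. Its nontrivial half: a
  factorisation of a permutation that moves \<open>a\<close> can be rewritten so that only its first factor
  moves \<open>a\<close>, without becoming longer.\<close>

lemma transposition_length_transpose_comp:
  assumes "permutation p" "p a = a" "a \<noteq> b"
  shows "transposition_length (transpose a b \<circ> p) = Suc (transposition_length p)"
proof (rule antisym)
  show "transposition_length (transpose a b \<circ> p) \<le> Suc (transposition_length p)"
    using assms by (intro transposition_length_le comp_Suc swapidseq_transposition_length)
next
  let ?q = "transpose a b \<circ> p"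
  have pq: "transpose a b \<circ> ?q = p"
    by (simp add: fun_eq_iff)
  have "permutation ?q"
    using assms(1) by (simp add: permutation_compose permutation_swap_id)
  then have "swapidseq (transposition_length ?q) ?q"
    by (rule swapidseq_transposition_length)
  from fixing_swapidseq_decrease[OF this \<open>a \<noteq> b\<close>]
  have "transposition_length ?q \<noteq> 0" "swapidseq (transposition_length ?q - 1) p"
    unfolding pq using assms(2) by auto
  then show "Suc (transposition_length p) \<le> transposition_length ?q"
    using transposition_length_le by fastforce
qed

text \<open>A cycle on \<open>l\<close> points is built by merging one new point after another, \<open>l - 1\<close> times,
  and every such step adds one to the length even in the presence of other, disjoint cycles.\<close>

lemma transposition_length_disjoint_cycle:
  assumes "distinct cs" "finite I" "p permutes I" "set cs \<inter> I = {}"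
  shows "transposition_length (cycle_of_list cs \<circ> p) = length cs - 1 + transposition_length p"
  using assms(1,4)
proof (induction cs rule: cycle_of_list.induct)
  case (1 i j cs)
  have "permutation (cycle_of_list (j # cs) \<circ> p)"
    by (intro permutation_compose permutation_of_cycle permutes_imp_permutation[OF assms(2,3)])
  moreover have "(cycle_of_list (j # cs) \<circ> p) i = i"
    using 1(2,3) permutes_not_in[OF assms(3)] by (auto intro!: id_outside_supp)
  ultimately have "transposition_length (transpose i j \<circ> (cycle_of_list (j # cs) \<circ> p)) =
      Suc (transposition_length (cycle_of_list (j # cs) \<circ> p))"
    using 1(2) by (intro transposition_length_transpose_comp) auto
  moreover have "transposition_length (cycle_of_list (j # cs) \<circ> p) =
      length (j # cs) - 1 + transposition_length p"
    by (rule 1(1)) (use 1(2,3) in auto)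
  ultimately show "transposition_length (cycle_of_list (i # j # cs) \<circ> p) =
      length (i # j # cs) - 1 + transposition_length p"
    by (simp add: comp_assoc del: comp_apply)
qed auto

lemma swapidseq_conj:
  assumes "bij s" "swapidseq l p"
  shows "swapidseq l (s \<circ> p \<circ> inv' s)"
  using assms(2)
proof (induction rule: swapidseq.induct)
  case id
  have "s \<circ> id \<circ> inv' s = id"
    using assms(1) by (simp add: fun_eq_iff bij_is_surj surj_f_inv_f)
  then show ?case by (metis swapidseq.id)
next
  case (comp_Suc n p a b)
  have "s \<circ> (transpose a b \<circ> p) \<circ> inv' s = transpose (s a) (s b) \<circ> (s \<circ> p \<circ> inv' s)"
    using assms(1) by (simp add: fun_eq_iff transpose_apply_commute bij_inv_eq_iff bij_is_inj transpose_def inj_eq)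
  moreover have "s a \<noteq> s b"
    using comp_Suc.hyps(2) assms(1) by (simp add: bij_is_inj inj_eq)
  ultimately show ?case
    using swapidseq.comp_Suc[OF comp_Suc.IH] by metis
qed

lemma conj_conj_inv:
  assumes "bij s"
  shows "inv' s \<circ> (s \<circ> p \<circ> inv' s) \<circ> inv' (inv' s) = p"
  using assms by (simp add: fun_eq_iff inv_inv_eq bij_is_inj)

lemma transposition_length_conj:
  assumes "bij s"
  shows "transposition_length (s \<circ> p \<circ> inv' s) = transposition_length p"
proof -
  have "swapidseq l (s \<circ> p \<circ> inv' s) \<longleftrightarrow> swapidseq l p" for l
    using swapidseq_conj[OF assms, of l p]
      swapidseq_conj[OF bij_imp_bij_inv[OF assms], of l "s \<circ> p \<circ> inv' s"] conj_conj_inv[OF assms, of p]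
    by auto
  then show ?thesis by (simp add: transposition_length_def)
qed

lemma evenperm_conj:
  assumes "permutation s" "permutation p"
  shows "evenperm (s \<circ> p \<circ> inv' s) \<longleftrightarrow> evenperm p"
  using assms
  by (simp add: evenperm_comp evenperm_inv permutation_compose permutation_inverse) blast

section \<open>Products of disjoint transpositions\<close>

text \<open>The set \<open>J\<close> records exactly the points moved by the product \<open>p\<close> of \<open>m\<close> disjoint
  transpositions. Keeping it exact makes its size \<open>2 * m\<close> available, which is what counts the
  fixed points left over for padding.\<close>

inductive disjoint_swaps :: "nat \<Rightarrow> 'a set \<Rightarrow> ('a \<Rightarrow> 'a) \<Rightarrow> bool" where
  empty: "disjoint_swaps 0 {} id"
| swap: "disjoint_swaps m J p \<Longrightarrow> a \<noteq> b \<Longrightarrow> a \<notin> J \<Longrightarrow> b \<notin> J \<Longrightarrow>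
    disjoint_swaps (Suc m) (insert a (insert b J)) (transpose a b \<circ> p)"

lemma disjoint_swaps_finite: "disjoint_swaps m J p \<Longrightarrow> finite J"
  by (induction rule: disjoint_swaps.induct) auto

lemma disjoint_swaps_card: "disjoint_swaps m J p \<Longrightarrow> card J = 2 * m"
proof (induction rule: disjoint_swaps.induct)
  case (swap m J p a b)
  then show ?case using disjoint_swaps_finite[OF swap(1)] by simp
qed simp

lemma disjoint_swaps_permutes: "disjoint_swaps m J p \<Longrightarrow> p permutes J"
proof (induction rule: disjoint_swaps.induct)
  case (swap m J p a b)
  then show ?case
    by (intro permutes_compose permutes_swap_id) (auto intro: permutes_subset)
qed (rule permutes_id)

lemma disjoint_swaps_swapidseq: "disjoint_swaps m J p \<Longrightarrow> swapidseq m p"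
  by (induction rule: disjoint_swaps.induct) (blast intro: swapidseq.intros)+

lemma disjoint_swaps_evenperm: "disjoint_swaps m J p \<Longrightarrow> evenperm p \<longleftrightarrow> even m"
  using disjoint_swaps_swapidseq evenperm_unique by blast

lemma disjoint_swaps_involution: "disjoint_swaps m J p \<Longrightarrow> p \<circ> p = id"
proof (induction rule: disjoint_swaps.induct)
  case (swap m J p a b)
  have "p permutes J" by (rule disjoint_swaps_permutes[OF swap(1)])
  then have "p x \<noteq> a" "p x \<noteq> b" if "x \<notin> {a, b}" for x
    using swap(3,4) that by (metis insertCI permutes_def)+
  moreover have "p a = a" "p b = b" using swap(3,4) \<open>p permutes J\<close> by (simp_all add: permutes_not_in)
  ultimately show ?case using swap(5)
    by (auto simp: fun_eq_iff transpose_def) 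
qed simp

lemma permutes_comp_commute:
  assumes "p permutes J" "q permutes K" "J \<inter> K = {}"
  shows "p \<circ> q = q \<circ> p"
proof
  fix x
  show "(p \<circ> q) x = (q \<circ> p) x"
  proof (cases "x \<in> J")
    case True
    then have "p x \<in> J" using assms(1) by (simp add: permutes_in_image)
    then show ?thesis using True assms permutes_not_in[OF assms(2)] by (auto simp: disjoint_iff)
  next
    case False
    show ?thesis
    proof (cases "x \<in> K")
      case True
      then have "q x \<in> K" using assms(2) by (simp add: permutes_in_image)
      then show ?thesis using False assms permutes_not_in[OF assms(1)] by (auto simp: disjoint_iff)
    next
      case False
      then show ?thesis using \<open>x \<notin> J\<close> assms by (simp add: permutes_not_in)
    qed
  qed
qed

lemma disjoint_swaps_comp:
  assumes "disjoint_swaps m J p" "disjoint_swaps l K q" "J \<inter> K = {}"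
  shows "disjoint_swaps (m + l) (J \<union> K) (p \<circ> q)"
  using assms(1,3)
proof (induction rule: disjoint_swaps.induct)
  case empty
  show "disjoint_swaps (0 + l) ({} \<union> K) (id \<circ> q)" using assms(2) by simp
next
  case (swap m J p a b)
  have "disjoint_swaps (m + l) (J \<union> K) (p \<circ> q)"
    by (rule swap.IH) (use swap.prems in auto)
  from disjoint_swaps.swap[OF this, of a b] swap.hyps swap.prems
  show "disjoint_swaps (Suc m + l) (insert a (insert b J) \<union> K) (transpose a b \<circ> p \<circ> q)"
    by (auto simp: comp_assoc)
qed

lemma disjoint_swaps_conj:
  assumes "bij s" "disjoint_swaps m J p"
  shows "disjoint_swaps m (s ` J) (s \<circ> p \<circ> inv' s)"
  using assms(2)
proof (induction rule: disjoint_swaps.induct)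
  case empty
  have "s \<circ> id \<circ> inv' s = id"
    using assms(1) by (simp add: fun_eq_iff bij_is_surj surj_f_inv_f)
  then show ?case by (metis disjoint_swaps.empty image_empty)
next
  case (swap m J p a b)
  have "s \<circ> (transpose a b \<circ> p) \<circ> inv' s = transpose (s a) (s b) \<circ> (s \<circ> p \<circ> inv' s)"
    using assms(1) by (simp add: fun_eq_iff bij_is_inj transpose_def inj_eq)
  moreover have "s a \<noteq> s b" "s a \<notin> s ` J" "s b \<notin> s ` J"
    using swap.hyps assms(1) by (auto simp: bij_is_inj inj_eq inj_image_mem_iff)
  ultimately show ?case
    using disjoint_swaps.swap[OF swap.IH, of "s a" "s b"] by (metis image_insert)
qed

lemma disjoint_swaps_split:
  "disjoint_swaps (l + m) J p \<Longrightarrow> \<exists>K L q r. disjoint_swaps l K q \<and> disjoint_swaps m L r \<and>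
     K \<inter> L = {} \<and> K \<union> L = J \<and> p = q \<circ> r"
proof (induction l arbitrary: J p)
  case 0
  show ?case
    by (rule exI[of _ "{}"], rule exI[of _ J], rule exI[of _ id], rule exI[of _ p],
        intro conjI disjoint_swaps.empty)
      (use 0 in simp_all)
next
  case (Suc l)
  from Suc.prems obtain J' p' a b where p:
    "disjoint_swaps (l + m) J' p'" "a \<noteq> b" "a \<notin> J'" "b \<notin> J'"
    "J = insert a (insert b J')" "p = transpose a b \<circ> p'"
    by (cases rule: disjoint_swaps.cases) auto
  from Suc.IH[OF p(1)] obtain K L q r where
    q: "disjoint_swaps l K q" "disjoint_swaps m L r" "K \<inter> L = {}" "K \<union> L = J'" "p' = q \<circ> r"
    by blast
  show ?case
    by (rule exI[of _ "insert a (insert b K)"], rule exI[of _ L],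
        rule exI[of _ "transpose a b \<circ> q"], rule exI[of _ r])
      (use p q in \<open>auto simp: comp_assoc intro: disjoint_swaps.swap simp del: comp_apply\<close>)
qed

lemma disjoint_swaps_exists:
  "finite X \<Longrightarrow> 2 * m \<le> card X \<Longrightarrow> \<exists>J\<subseteq>X. \<exists>p. disjoint_swaps m J p"
proof (induction m)
  case 0
  then show ?case by (auto intro: disjoint_swaps.empty)
next
  case (Suc m)
  then obtain J p where J: "J \<subseteq> X" "disjoint_swaps m J p" by auto
  have "2 \<le> card (X - J)"
    using Suc.prems J disjoint_swaps_card[OF J(2)] disjoint_swaps_finite[OF J(2)]
    by (simp add: card_Diff_subset)
  then obtain T where "T \<subseteq> X - J" "card T = 2" by (meson obtain_subset_with_card_n)
  then obtain a b where "a \<noteq> b" "a \<in> X - J" "b \<in> X - J" by (auto simp: card_2_iff)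
  then have "insert a (insert b J) \<subseteq> X" "disjoint_swaps (Suc m) (insert a (insert b J)) (transpose a b \<circ> p)"
    using J by (auto intro: disjoint_swaps.swap)
  then show ?case by blast
qed

lemma k_transpositions_eq:
  "k_transpositions k n = {p. \<exists>J\<subseteq>{1..n}. disjoint_swaps k J p}"
proof (intro equalityI subsetI)
  fix p assume "p \<in> k_transpositions k n"
  then obtain ts where ts: "p = foldr (\<lambda>(a, b) p. transpose a b \<circ> p) ts id" "length ts = k"
    "distinct (map fst ts @ map snd ts)" "set (map fst ts @ map snd ts) \<subseteq> {1..n}"
    unfolding k_transpositions_def by blast
  have "disjoint_swaps (length ts) (set (map fst ts @ map snd ts))
      (foldr (\<lambda>(a, b) p. transpose a b \<circ> p) ts id)"
    using ts(3)
  proof (induction ts)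
    case (Cons t ts)
    have "disjoint_swaps (length ts) (set (map fst ts @ map snd ts))
        (foldr (\<lambda>(a, b) p. transpose a b \<circ> p) ts id)"
      by (rule Cons.IH) (use Cons.prems in auto)
    then have "disjoint_swaps (Suc (length ts))
        (insert (fst t) (insert (snd t) (set (map fst ts @ map snd ts))))
        (transpose (fst t) (snd t) \<circ> foldr (\<lambda>(a, b) p. transpose a b \<circ> p) ts id)"
      using Cons.prems by (intro disjoint_swaps.swap) auto
    then show "disjoint_swaps (length (t # ts)) (set (map fst (t # ts) @ map snd (t # ts)))
        (foldr (\<lambda>(a, b) p. transpose a b \<circ> p) (t # ts) id)"
      by (simp add: case_prod_beta)
  next
    case Nil
    show "disjoint_swaps (length []) (set (map fst [] @ map snd []))
        (foldr (\<lambda>(a, b) p. transpose a b \<circ> p) [] id)"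
      by (simp add: disjoint_swaps.empty)
  qed
  with ts show "p \<in> {p. \<exists>J\<subseteq>{1..n}. disjoint_swaps k J p}" by blast
next
  fix p assume "p \<in> {p. \<exists>J\<subseteq>{1..n}. disjoint_swaps k J p}"
  then obtain J where J: "J \<subseteq> {1..n}" "disjoint_swaps k J p" by blast
  from J(2) have "\<exists>ts. p = foldr (\<lambda>(a, b) p. transpose a b \<circ> p) ts id \<and> length ts = k \<and>
    distinct (map fst ts @ map snd ts) \<and> set (map fst ts @ map snd ts) = J"
  proof (induction rule: disjoint_swaps.induct)
    case (swap m J p a b)
    then obtain ts where "p = foldr (\<lambda>(a, b) p. transpose a b \<circ> p) ts id" "length ts = m"
      "distinct (map fst ts @ map snd ts)" "set (map fst ts @ map snd ts) = J"
      by blast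
    with swap.hyps show "\<exists>ts. transpose a b \<circ> p = foldr (\<lambda>(a, b) p. transpose a b \<circ> p) ts id \<and>
        length ts = Suc m \<and> distinct (map fst ts @ map snd ts) \<and>
        set (map fst ts @ map snd ts) = insert a (insert b J)"
      by (intro exI[of _ "(a, b) # ts"]) auto
  qed simp
  with J(1) show "p \<in> k_transpositions k n" unfolding k_transpositions_def by blast
qed

section \<open>Balanced factorisations into two involutions\<close>

text \<open>Swap the first and the last entry, then treat the list in between. In the geometric picture this is
  a reflection of a polygon.\<close>

lemma disjoint_swaps_reversing_list:
  "distinct cs \<Longrightarrow>
     \<exists>J\<subseteq>set cs. \<exists>x. disjoint_swaps (length cs div 2) J x \<and> map x cs = rev cs"
proof (induction "length cs" arbitrary: cs rule: less_induct)
  case less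
  consider "cs = []" | a where "cs = [a]" | a ds b where "cs = a # ds @ [b]"
    by (metis list.exhaust rev_exhaust)
  then show ?case
  proof cases
    case 1
    then show ?thesis by (auto intro!: exI[of _ id] disjoint_swaps.empty)
  next
    case 2
    then show ?thesis by (auto intro!: exI[of _ "{}"] exI[of _ id] disjoint_swaps.empty)
  next
    case 3
    from less(1)[of ds] less(2) 3 obtain J x where J: "J \<subseteq> set ds"
      "disjoint_swaps (length ds div 2) J x" "map x ds = rev ds" by auto
    have d: "a \<noteq> b" "a \<notin> set ds" "b \<notin> set ds" using less(2) 3 by auto
    have "x a = a" "x b = b"
      using d J(1) permutes_not_in[OF disjoint_swaps_permutes[OF J(2)]] by auto
    moreover have "map (transpose a b \<circ> x) ds = rev ds"
    proof -
      have "map (transpose a b \<circ> x) ds = map (transpose a b) (rev ds)" using J(3) by (simp flip: map_map)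
      also have "\<dots> = rev ds" using d by (intro map_idI) (auto simp: transpose_eq_iff)
      finally show ?thesis .
    qed
    ultimately have "map (transpose a b \<circ> x) cs = rev cs" using 3 by simp
    moreover have "disjoint_swaps (length cs div 2) (insert a (insert b J)) (transpose a b \<circ> x)"
      using disjoint_swaps.swap[OF J(2), of a b] d J(1) 3 by auto
    moreover have "insert a (insert b J) \<subseteq> set cs" using J(1) 3 by auto
    ultimately show ?thesis by blast
  qed
qed

text \<open>A rotation of a polygon is the product of two reflections. Reversing the whole list and then
  reversing all but the entry that has come to the end shifts every entry by one place; each of
  the two reversals has about half as many transpositions as the cycle has points.\<close>

lemma cycle_eq_two_reversals:
  assumes "distinct cs"
  shows "\<exists>J K x y. disjoint_swaps ((length cs - 1) div 2) J x \<and> disjoint_swaps (length cs div 2) K y \<and>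
     J \<subseteq> set cs \<and> K \<subseteq> set cs \<and> cycle_of_list cs = x \<circ> y"
proof (cases cs)
  case Nil
  show ?thesis
    by (rule exI[of _ "{}"], rule exI[of _ "{}"], rule exI[of _ id], rule exI[of _ id])
      (use Nil in \<open>auto intro: disjoint_swaps.empty\<close>)
next
  case (Cons a ds)
  obtain K y where K: "K \<subseteq> set cs" "disjoint_swaps (length cs div 2) K y" "map y cs = rev cs"
    using disjoint_swaps_reversing_list[OF assms] by blast
  obtain J x where J: "J \<subseteq> set ds" "disjoint_swaps (length ds div 2) J x" "map x ds = rev ds"
    using disjoint_swaps_reversing_list[of ds] assms Cons by auto
  have "map (x \<circ> y) cs = map x (rev ds @ [a])" using K(3) Cons by (metis map_map rev.simps(2))
  also have "\<dots> = rev (map x ds) @ [x a]" by (simp add: rev_map)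
  also have "x a = a"
    using assms Cons J(1) permutes_not_in[OF disjoint_swaps_permutes[OF J(2)]] by auto
  also have "rev (map x ds) @ [a] = rotate1 cs" using J(3) Cons by simp
  also have "\<dots> = map (cycle_of_list cs) cs" using cyclic_rotation[OF assms, of 1] by simp
  finally have on: "(x \<circ> y) z = cycle_of_list cs z" if "z \<in> set cs" for z using that by auto
  have "J \<subseteq> set cs" using J(1) Cons by auto
  have "(x \<circ> y) z = cycle_of_list cs z" for z
  proof (cases "z \<in> set cs")
    case False
    then have "y z = z" "x z = z"
      using K(1) \<open>J \<subseteq> set cs\<close> permutes_not_in[OF disjoint_swaps_permutes[OF J(2)]]
        permutes_not_in[OF disjoint_swaps_permutes[OF K(2)]] by auto
    then show ?thesis using False by (simp add: id_outside_supp)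
  qed (rule on)
  then have "cycle_of_list cs = x \<circ> y" by (simp add: fun_eq_iff)
  with K J(2) \<open>J \<subseteq> set cs\<close> Cons show ?thesis by auto
qed

text \<open>The involutions in a factorisation may trade places, since \<open>x \<circ> y = (x \<circ> y \<circ> inv x) \<circ> x\<close> and
  conjugation preserves the cycle type. This is used to decide which of the two factors gets
  the larger number of transpositions.\<close>

lemma disjoint_swaps_comp_swap:
  assumes "disjoint_swaps a J x" "disjoint_swaps b K y" "J \<subseteq> I" "K \<subseteq> I"
  shows "\<exists>K' y'. disjoint_swaps b K' y' \<and> K' \<subseteq> I \<and> x \<circ> y = y' \<circ> x"
proof -
  have x: "x permutes I" using assms disjoint_swaps_permutes permutes_subset by blast
  show ?thesis
  proof (intro exI conjI)
    show "disjoint_swaps b (x ` K) (x \<circ> y \<circ> inv' x)"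
      using disjoint_swaps_conj[OF permutes_bij[OF x] assms(2)] .
    show "x ` K \<subseteq> I" using assms(4) permutes_image[OF x] by blast
    show "x \<circ> y = x \<circ> y \<circ> inv' x \<circ> x" using permutes_inv_o(2)[OF x] by (simp add: comp_assoc)
  qed
qed

text \<open>Each cycle of \<open>p\<close> contributes to the two factors numbers of transpositions that differ by at most
  one (and differ exactly for the cycles of even length). Choosing, cycle by cycle, the order of the
  two reflections so that a new surplus cancels an old one keeps the totals balanced. No
  transposition is wasted: the total is the length of \<open>p\<close>.\<close>

lemma balanced_factorisation:
  assumes "p permutes I" "finite I"
  shows "\<exists>a b J K x y. disjoint_swaps a J x \<and> disjoint_swaps b K y \<and> J \<subseteq> I \<and> K \<subseteq> I \<and>
    p = x \<circ> y \<and> a + b = transposition_length p \<and> (a = b \<or> a = Suc b)"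
  using cycle_decomposition[OF assms]
proof (induction rule: cycle_decomp.induct)
  case empty
  show "\<exists>a b J K x y. disjoint_swaps a J x \<and> disjoint_swaps b K y \<and> J \<subseteq> {} \<and> K \<subseteq> {} \<and>
    id = x \<circ> y \<and> a + b = transposition_length id \<and> (a = b \<or> a = Suc b)"
    by (rule exI[of _ 0], rule exI[of _ 0], rule exI[of _ "{}"], rule exI[of _ "{}"],
        rule exI[of _ id], rule exI[of _ id]) (auto intro: disjoint_swaps.empty)
next
  case (comp I p cs)
  from comp.IH obtain a b J K x y where p: "disjoint_swaps a J x" "disjoint_swaps b K y"
    "J \<subseteq> I" "K \<subseteq> I" "p = x \<circ> y" "a + b = transposition_length p" "a = b \<or> a = Suc b"
    by blast
  have perm: "p permutes J \<union> K"
    using p disjoint_swaps_permutes[OF p(1)] disjoint_swaps_permutes[OF p(2)]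
    by (auto intro!: permutes_compose elim: permutes_subset)
  have len: "transposition_length (cycle_of_list cs \<circ> p) = length cs - 1 + transposition_length p"
    using comp.hyps p perm disjoint_swaps_finite
    by (intro transposition_length_disjoint_cycle[of _ "J \<union> K"]) auto
  define c d where "c = (length cs - 1) div 2" and "d = length cs div 2"
  have cd: "c + d = length cs - 1" "d = c \<or> d = Suc c" unfolding c_def d_def by presburger+
  obtain J1 K1 x1 y1 where cyc: "disjoint_swaps c J1 x1" "disjoint_swaps d K1 y1"
    "J1 \<subseteq> set cs" "K1 \<subseteq> set cs" "cycle_of_list cs = x1 \<circ> y1"
    using cycle_eq_two_reversals[OF comp.hyps(2)] unfolding c_def d_def by blast
  obtain K2 y2 where cyc': "disjoint_swaps d K2 y2" "K2 \<subseteq> set cs" "cycle_of_list cs = y2 \<circ> x1"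
    using disjoint_swaps_comp_swap[OF cyc(1-4)] cyc(5) by metis
  \<comment> \<open>The two candidates for the factors of the cycle differ in where the surplus sits; either one
    may be combined with the factors of \<open>p\<close> as long as the balance is preserved.\<close>
  have merge: "\<exists>a b J K x y. disjoint_swaps a J x \<and> disjoint_swaps b K y \<and>
      J \<subseteq> set cs \<union> I \<and> K \<subseteq> set cs \<union> I \<and> cycle_of_list cs \<circ> p = x \<circ> y \<and>
      a + b = transposition_length (cycle_of_list cs \<circ> p) \<and> (a = b \<or> a = Suc b)"
    if q: "disjoint_swaps c' J' x'" "disjoint_swaps d' K' y'" "J' \<subseteq> set cs" "K' \<subseteq> set cs"
      "cycle_of_list cs = x' \<circ> y'" "c' + d' = length cs - 1" "c' + a = d' + b \<or> c' + a = Suc (d' + b)"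
    for c' d' J' K' x' y'
  proof -
    have dis: "J' \<inter> J = {}" "K' \<inter> K = {}" "K' \<inter> J = {}"
      using q p comp.hyps(3) by blast+
    have "y' \<circ> x = x \<circ> y'"
      by (rule permutes_comp_commute[OF disjoint_swaps_permutes[OF q(2)] disjoint_swaps_permutes[OF p(1)] dis(3)])
    then have "x' \<circ> (y' \<circ> x) \<circ> y = x' \<circ> (x \<circ> y') \<circ> y" by (simp only:)
    then have "x' \<circ> y' \<circ> (x \<circ> y) = (x' \<circ> x) \<circ> (y' \<circ> y)" by (simp only: comp_assoc)
    then have eq: "cycle_of_list cs \<circ> p = (x' \<circ> x) \<circ> (y' \<circ> y)"
      using q(5) p(5) by (simp only:)
    show ?thesis
      by (rule exI[of _ "c' + a"], rule exI[of _ "d' + b"], rule exI[of _ "J' \<union> J"], rule exI[of _ "K' \<union> K"],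
          rule exI[of _ "x' \<circ> x"], rule exI[of _ "y' \<circ> y"])
        (use q p len eq disjoint_swaps_comp[OF q(1) p(1) dis(1)] disjoint_swaps_comp[OF q(2) p(2) dis(2)]
          in \<open>auto simp del: comp_apply\<close>)
  qed
  show ?case
  proof (cases "a = b")
    case True
    then show ?thesis
      using cd by (intro merge[OF cyc'(1) cyc(1) cyc'(2) cyc(3) cyc'(3)]) auto
  next
    case False
    then show ?thesis
      using cd p(7) by (intro merge[OF cyc(1-5)]) auto
  qed
qed

section \<open>Balls in Cayley graphs\<close>

lemma pverts_cayley_graph [simp]: "pverts (cayley_graph G H) = generate G H"
  by (simp add: cayley_graph_def)

lemma parcs_cayley_graph [simp]:
  "(u, v) \<in> parcs (cayley_graph G H) \<longleftrightarrow>
     u \<in> generate G H \<and> v \<in> generate G H \<and> u \<noteq> v \<and> (\<exists>h\<in>H. v = u \<otimes>\<^bsub>G\<^esub> h)"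
  by (simp add: cayley_graph_def)

context group
begin

lemma foldr_mult_closed:
  "set hs \<subseteq> carrier G \<Longrightarrow> foldr (\<otimes>) hs \<one> \<in> carrier G"
  by (induction hs) auto

text \<open>The letters of the word are the labels of the arcs of the walk.\<close>

lemma cayley_graph_walkD:
  assumes H: "H \<subseteq> carrier G"
    and "pre_digraph.awalk (with_proj (cayley_graph G H)) u p v"
  shows "\<exists>hs. set hs \<subseteq> H \<and> length hs = length p \<and> v = u \<otimes> foldr (\<otimes>) hs \<one>"
  using assms(2)
proof (induction p arbitrary: u)
  interpret W: wf_digraph "with_proj (cayley_graph G H)" by (rule wf_digraph_cayley_graph)
  have gen: "generate G H \<subseteq> carrier G" using generate_incl[OF H] .
  {
    case Nil
    then have "u = v" "u \<in> generate G H"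
      by (auto simp: W.awalk_Nil_iff)
    then show ?case using gen by (auto intro!: exI[of _ "[]"])
  next
    case (Cons e p)
    from Cons.prems obtain w h where e: "e = (u, w)" "u \<in> generate G H" "h \<in> H" "w = u \<otimes> h"
      and p: "W.awalk w p v"
      by (cases e) (auto simp: W.awalk_Cons_iff)
    from Cons.IH[OF p] obtain hs where hs: "set hs \<subseteq> H" "length hs = length p" "v = w \<otimes> foldr (\<otimes>) hs \<one>"
      by blast
    have "v = u \<otimes> foldr (\<otimes>) (h # hs) \<one>"
      using e hs gen H foldr_mult_closed[of hs] by (auto simp: m_assoc subset_iff)
    with e hs show ?case by (intro exI[of _ "h # hs"]) auto
  }
qed

text \<open>The walk may be shorter than the word, because the neutral element, should it occur as a letter,
  labels no arc.\<close>

lemma cayley_graph_walkI: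
  assumes H: "H \<subseteq> carrier G"
  shows "set hs \<subseteq> H \<Longrightarrow> u \<in> generate G H \<Longrightarrow>
    \<exists>p. pre_digraph.awalk (with_proj (cayley_graph G H)) u p (u \<otimes> foldr (\<otimes>) hs \<one>) \<and> length p \<le> length hs"
proof (induction hs arbitrary: u)
  interpret W: wf_digraph "with_proj (cayley_graph G H)" by (rule wf_digraph_cayley_graph)
  have gen: "generate G H \<subseteq> carrier G" using generate_incl[OF H] .
  {
    case Nil
    have "W.awalk u [] u"
      using Nil.prems by (simp add: W.awalk_Nil_iff)
    then show ?case using gen Nil.prems by (auto intro!: exI[of _ "[]"])
  next
    case (Cons h hs)
    then have h: "h \<in> H" "h \<in> generate G H" by (auto intro: generate.incl)
    then have uh: "u \<otimes> h \<in> generate G H" using Cons.prems by (auto intro: generate.eng)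
    from Cons.IH[OF _ uh] Cons.prems obtain p where
      p: "W.awalk (u \<otimes> h) p (u \<otimes> h \<otimes> foldr (\<otimes>) hs \<one>)" "length p \<le> length hs"
      by auto
    have assoc: "u \<otimes> h \<otimes> foldr (\<otimes>) hs \<one> = u \<otimes> foldr (\<otimes>) (h # hs) \<one>"
      using Cons.prems h gen H foldr_mult_closed[of hs] by (auto simp: m_assoc subset_iff)
    show ?case
    proof (cases "u \<otimes> h = u")
      case True
      then show ?thesis using p assoc by (intro exI[of _ p]) auto
    next
      case False
      then have "W.awalk u ((u, u \<otimes> h) # p) (u \<otimes> foldr (\<otimes>) (h # hs) \<one>)"
        using p(1) assoc Cons.prems(2) uh h(1) by (auto simp: W.awalk_Cons_iff)
      then show ?thesis using p(2) by (intro exI[of _ "(u, u \<otimes> h) # p"]) auto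
    qed
  }
qed

end

text \<open>The distance is an infimum of extended reals; since all walk lengths are natural numbers, a bound by
  a natural number is witnessed by a walk.\<close>

lemma graph_dist_le_iff:
  assumes "wf_digraph (with_proj \<Gamma>)"
  shows "graph_dist \<Gamma> u v \<le> ereal (real r) \<longleftrightarrow>
    (\<exists>p. pre_digraph.awalk (with_proj \<Gamma>) u p v \<and> length p \<le> r)"
proof -
  interpret W: wf_digraph "with_proj \<Gamma>" by fact
  have cost: "W.awalk_cost (\<lambda>_. 1) p = real (length p)" for p
    by (induction p) (auto simp: W.awalk_cost_def)
  show ?thesis
  proof
    assume "\<exists>p. W.awalk u p v \<and> length p \<le> r"
    then obtain p where "W.awalk u p v" "length p \<le> r" by blast
    with W.min_cost_le_walk_cost[of u p v "\<lambda>_. 1"] show "graph_dist \<Gamma> u v \<le> ereal (real r)"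
      unfolding graph_dist_def cost by (meson ereal_less_eq(3) of_nat_le_iff order_trans)
  next
    assume le: "graph_dist \<Gamma> u v \<le> ereal (real r)"
    show "\<exists>p. W.awalk u p v \<and> length p \<le> r"
    proof (rule ccontr)
      assume "\<not> ?thesis"
      then have "ereal (real (Suc r)) \<le> ereal (W.awalk_cost (\<lambda>_. 1) p)" if "W.awalk u p v" for p
        using that unfolding cost by (simp add: not_le) (metis Suc_leI not_le of_nat_Suc of_nat_le_iff)
      then have "ereal (real (Suc r)) \<le> graph_dist \<Gamma> u v"
        unfolding graph_dist_def W.\<mu>_def by (intro INF_greatest) auto
      then have "ereal (real (Suc r)) \<le> ereal (real r)" using le by (rule order_trans)
      then show False by simp
    qed
  qed
qed

lemma (in group) graph_ball_cayley_graph: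
  assumes H: "H \<subseteq> carrier G" and g: "g \<in> generate G H"
  shows "graph_ball (cayley_graph G H) r g =
    {g \<otimes> foldr (\<otimes>) hs \<one> | hs. set hs \<subseteq> H \<and> length hs \<le> r}"
proof (intro equalityI subsetI)
  fix u assume "u \<in> graph_ball (cayley_graph G H) r g"
  then obtain p where "pre_digraph.awalk (with_proj (cayley_graph G H)) g p u" "length p \<le> r"
    unfolding graph_ball_def graph_dist_le_iff[OF wf_digraph_cayley_graph] by blast
  with cayley_graph_walkD[OF H this(1)]
  show "u \<in> {g \<otimes> foldr (\<otimes>) hs \<one> | hs. set hs \<subseteq> H \<and> length hs \<le> r}" by auto
next
  interpret W: wf_digraph "with_proj (cayley_graph G H)" by (rule wf_digraph_cayley_graph)
  fix u assume "u \<in> {g \<otimes> foldr (\<otimes>) hs \<one> | hs. set hs \<subseteq> H \<and> length hs \<le> r}"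
  then obtain hs where hs: "u = g \<otimes> foldr (\<otimes>) hs \<one>" "set hs \<subseteq> H" "length hs \<le> r" by blast
  from cayley_graph_walkI[OF H hs(2) g] obtain p where
    p: "W.awalk g p u" "length p \<le> length hs" unfolding hs(1) by blast
  have "u \<in> pverts (cayley_graph G H)" using W.awalk_last_in_verts[OF p(1)] by simp
  moreover have "length p \<le> r" using p(2) hs(3) by simp
  ultimately show "u \<in> graph_ball (cayley_graph G H) r g"
    using p(1) unfolding graph_ball_def graph_dist_le_iff[OF wf_digraph_cayley_graph] by blast
qed

section \<open>Balls around permutations\<close>

lemma k_transpositionsI:
  "disjoint_swaps k J p \<Longrightarrow> J \<subseteq> {1..n} \<Longrightarrow> p \<in> k_transpositions k n"
  unfolding k_transpositions_eq by blast

lemma k_transpositions_facts: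
  assumes "h \<in> k_transpositions k n"
  shows "h permutes {1..n}" "transposition_length h \<le> k" "evenperm h \<longleftrightarrow> even k" "h \<circ> h = id"
proof -
  obtain J where J: "J \<subseteq> {1..n}" "disjoint_swaps k J h"
    using assms unfolding k_transpositions_eq by blast
  show "h permutes {1..n}" using disjoint_swaps_permutes[OF J(2)] J(1) by (rule permutes_subset)
  show "transposition_length h \<le> k" using disjoint_swaps_swapidseq[OF J(2)] by (rule transposition_length_le)
  show "evenperm h \<longleftrightarrow> even k" using disjoint_swaps_evenperm[OF J(2)] .
  show "h \<circ> h = id" using disjoint_swaps_involution[OF J(2)] .
qed

text \<open>The products in the symmetric group, under a name of their own so that rewriting does not
  expand the compositions into applications to points.\<close>

definition word_product :: "('a \<Rightarrow> 'a) list \<Rightarrow> 'a \<Rightarrow> 'a" where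
  "word_product hs = foldr (\<circ>) hs id"

lemma word_product_simps [simp]:
  "word_product [] = id"
  "word_product (h # hs) = h \<circ> word_product hs"
  by (simp_all add: word_product_def)

lemma word_facts:
  assumes "set hs \<subseteq> k_transpositions k n"
  shows "word_product hs permutes {1..n} \<and>
    transposition_length (word_product hs) \<le> length hs * k \<and>
    (even k \<longrightarrow> evenperm (word_product hs))"
  using assms
proof (induction hs)
  case Nil
  show "word_product [] permutes {1..n} \<and> transposition_length (word_product []) \<le> length [] * k \<and>
    (even k \<longrightarrow> evenperm (word_product []))"
    by (simp add: permutes_id)
next
  case (Cons h hs)
  let ?w = "word_product hs"
  have h: "h permutes {1..n}" "transposition_length h \<le> k" "evenperm h \<longleftrightarrow> even k"
    using k_transpositions_facts[of h k n] Cons.prems by auto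
  have w: "?w permutes {1..n}" "transposition_length ?w \<le> length hs * k" "even k \<longrightarrow> evenperm ?w"
    using Cons by auto
  have perm: "permutation h" "permutation ?w"
    using h(1) w(1) by (auto intro: permutes_imp_permutation)
  show ?case
    using permutes_compose[OF w(1) h(1)] transposition_length_comp_le[OF perm] h(2) w(2)
      evenperm_comp[OF perm] h(3) w(3)
    by (auto simp del: comp_apply)
qed

lemma word_product_snoc: "word_product (hs @ [h]) = word_product hs \<circ> h"
  by (induction hs) (auto simp: comp_assoc)

text \<open>As \<open>u\<close> is even, the two factors of its balanced factorisation have the same number
  \<open>a \<le> k\<close> of transpositions. Multiplying both by the same \<open>k - a\<close> further disjoint
  transpositions does not change the product. These need \<open>2 * (k - a)\<close> points outside the at most
  \<open>4 * a\<close> points in use, and \<open>4 * a + 2 * (k - a) \<le> 4 * k\<close> because \<open>a \<le> k\<close>.\<close>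

lemma product_of_two_k_transpositions:
  assumes u: "u permutes {1..n}" "evenperm u" and n: "4 * k \<le> n"
    and len: "transposition_length u \<le> 2 * k"
  shows "\<exists>h\<in>k_transpositions k n. \<exists>h'\<in>k_transpositions k n. u = h \<circ> h'"
proof -
  obtain a b J K x y where xy: "disjoint_swaps a J x" "disjoint_swaps b K y" "J \<subseteq> {1..n}" "K \<subseteq> {1..n}"
    "u = x \<circ> y" "a + b = transposition_length u" "a = b \<or> a = Suc b"
    using balanced_factorisation[OF u(1) finite_atLeastAtMost] by blast
  have "even (transposition_length u)"
    using evenperm_iff_even_transposition_length u by (metis finite_atLeastAtMost permutes_imp_permutation)
  then have "a = b" using xy(6,7) by (metis even_add even_Suc)
  then have "a \<le> k" using xy(6) len by simp
  have "card (J \<union> K) \<le> 4 * a"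
    using card_Un_le[of J K] disjoint_swaps_card[OF xy(1)] disjoint_swaps_card[OF xy(2)] \<open>a = b\<close> by simp
  then have "2 * (k - a) \<le> card ({1..n} - (J \<union> K))"
    using n \<open>a \<le> k\<close> xy(3,4) disjoint_swaps_finite[OF xy(1)] disjoint_swaps_finite[OF xy(2)]
    by (simp add: card_Diff_subset)
  then obtain L z where z: "L \<subseteq> {1..n} - (J \<union> K)" "disjoint_swaps (k - a) L z"
    using disjoint_swaps_exists[of "{1..n} - (J \<union> K)" "k - a"] by auto
  from disjoint_swaps_comp[OF xy(1) z(2)] disjoint_swaps_comp[OF z(2) xy(2)]
  have "disjoint_swaps k (J \<union> L) (x \<circ> z)" "disjoint_swaps k (L \<union> K) (z \<circ> y)"
    using z(1) \<open>a = b\<close> \<open>a \<le> k\<close>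
    by auto
  then have mem: "x \<circ> z \<in> k_transpositions k n" "z \<circ> y \<in> k_transpositions k n"
    using xy(3,4) z(1) by (auto intro!: k_transpositionsI simp del: comp_apply)
  have u_eq: "u = (x \<circ> z) \<circ> (z \<circ> y)"
  proof -
    have "(x \<circ> z) \<circ> (z \<circ> y) = x \<circ> (z \<circ> z) \<circ> y" by (simp only: comp_assoc)
    then show ?thesis using xy(5) by (simp only: disjoint_swaps_involution[OF z(2)] comp_id)
  qed
  show ?thesis
    by (rule bexI[of _ "x \<circ> z"], rule bexI[of _ "z \<circ> y"], rule u_eq, (rule mem)+)
qed

text \<open>By balance, each factor of the balanced factorisation \<open>u = x \<circ> y\<close> has at least \<open>k\<close>
  transpositions, and \<open>k\<close> of those in \<open>y\<close> can be cancelled from the right.\<close>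

lemma k_transposition_shortens:
  assumes u: "u permutes {1..n}" and len: "2 * k \<le> transposition_length u"
  shows "\<exists>h\<in>k_transpositions k n. transposition_length (u \<circ> h) + k \<le> transposition_length u"
proof -
  obtain a b J K x y where xy: "disjoint_swaps a J x" "disjoint_swaps b K y" "J \<subseteq> {1..n}" "K \<subseteq> {1..n}"
    "u = x \<circ> y" "a + b = transposition_length u" "a = b \<or> a = Suc b"
    using balanced_factorisation[OF u finite_atLeastAtMost] by blast
  have "k \<le> b" using xy(6,7) len by linarith
  then have "disjoint_swaps (b - k + k) K y" using xy(2) by simp
  from disjoint_swaps_split[OF this] obtain K' L y' h where
    yh: "disjoint_swaps (b - k) K' y'" "disjoint_swaps k L h" "K' \<union> L = K" "y = y' \<circ> h"
    by blast
  have h: "h \<in> k_transpositions k n" using yh(3) xy(4) by (intro k_transpositionsI[OF yh(2)]) auto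
  have "u \<circ> h = x \<circ> y' \<circ> (h \<circ> h)" unfolding xy(5) yh(4) by (simp only: comp_assoc)
  also have "\<dots> = x \<circ> y'" by (simp only: disjoint_swaps_involution[OF yh(2)] comp_id)
  finally have uh: "u \<circ> h = x \<circ> y'" .
  have "transposition_length (x \<circ> y') \<le> a + (b - k)"
    by (intro transposition_length_le swapidseq_comp_add disjoint_swaps_swapidseq[OF xy(1)]
        disjoint_swaps_swapidseq[OF yh(1)])
  then have "transposition_length (x \<circ> y') + k \<le> transposition_length u"
    using \<open>k \<le> b\<close> xy(6) by linarith
  then have "transposition_length (u \<circ> h) + k \<le> transposition_length u"
    unfolding uh .
  from this h show ?thesis ..
qed

text \<open>Long permutations are shortened by one \<open>k\<close>-transposition at a time until the length is at most
  \<open>2 * k\<close>, where two factors suffice. The induction starts at radius 2 because a single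
  \<open>k\<close>-transposition cannot express an even permutation of length less than \<open>k\<close>.\<close>

lemma even_perm_as_word:
  assumes k: "even k" "4 * k \<le> n" and r: "2 \<le> r"
  shows "u permutes {1..n} \<Longrightarrow> evenperm u \<Longrightarrow> transposition_length u \<le> r * k \<Longrightarrow>
    \<exists>hs. set hs \<subseteq> k_transpositions k n \<and> length hs \<le> r \<and> u = word_product hs"
  using r
proof (induction r arbitrary: u rule: dec_induct)
  case base
  from product_of_two_k_transpositions[OF base(1,2) k(2) base(3)]
  obtain h h' where "h \<in> k_transpositions k n" "h' \<in> k_transpositions k n" "u = h \<circ> h'"
    by blast
  then show ?case by (intro exI[of _ "[h, h']"]) auto
next
  case (step r)
  show ?case
  proof (cases "2 * k \<le> transposition_length u")
    case False
    then have "transposition_length u \<le> r * k" using step.hyps(1) by (meson le_trans mult_le_mono1 nat_le_linear)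
    from step.IH[OF step.prems(1,2) this] show ?thesis using le_SucI by blast
  next
    case True
    obtain h where h: "h \<in> k_transpositions k n" "transposition_length (u \<circ> h) + k \<le> transposition_length u"
      using k_transposition_shortens[OF step.prems(1) True] by blast
    note hf = k_transpositions_facts[OF h(1)]
    have "u \<circ> h permutes {1..n}" using permutes_compose[OF hf(1) step.prems(1)] .
    moreover have "evenperm (u \<circ> h)"
      using evenperm_comp[of u h] step.prems(1,2) hf(1,3) k(1) by (auto intro: permutes_imp_permutation)
    moreover have "transposition_length (u \<circ> h) \<le> r * k" using h(2) step.prems(3) by simp
    ultimately obtain hs where hs: "set hs \<subseteq> k_transpositions k n" "length hs \<le> r" "u \<circ> h = word_product hs"
      using step.IH by blast
    have "u = (u \<circ> h) \<circ> h" using hf(4) by (simp add: comp_assoc)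
    also have "\<dots> = word_product (hs @ [h])" unfolding hs(3) word_product_snoc ..
    finally show ?thesis using hs(1,2) h(1) by (intro exI[of _ "hs @ [h]"]) auto
  qed
qed

lemma disjoint_swaps_as_word:
  "disjoint_swaps m J x \<Longrightarrow> J \<subseteq> {1..n} \<Longrightarrow>
     \<exists>hs. set hs \<subseteq> k_transpositions 1 n \<and> length hs = m \<and> x = word_product hs"
proof (induction rule: disjoint_swaps.induct)
  case empty
  show "\<exists>hs. set hs \<subseteq> k_transpositions 1 n \<and> length hs = 0 \<and> id = word_product hs" by simp
next
  case (swap m J p a b)
  then obtain hs where "set hs \<subseteq> k_transpositions 1 n" "length hs = m" "p = word_product hs" by auto
  moreover have "disjoint_swaps 1 {a, b} (transpose a b)"
    using disjoint_swaps.swap[OF disjoint_swaps.empty swap.hyps(2)] by simp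
  then have "transpose a b \<in> k_transpositions 1 n"
    by (rule k_transpositionsI) (use swap.prems in auto)
  ultimately show "\<exists>hs. set hs \<subseteq> k_transpositions 1 n \<and> length hs = Suc m \<and>
      transpose a b \<circ> p = word_product hs"
    by (intro exI[of _ "transpose a b # hs"]) auto
qed

lemma perm_as_word_of_transpositions:
  assumes "u permutes {1..n}"
  shows "\<exists>hs. set hs \<subseteq> k_transpositions 1 n \<and> length hs = transposition_length u \<and> u = word_product hs"
proof -
  obtain a b J K x y where xy: "disjoint_swaps a J x" "disjoint_swaps b K y" "J \<subseteq> {1..n}" "K \<subseteq> {1..n}"
    "u = x \<circ> y" "a + b = transposition_length u"
    using balanced_factorisation[OF assms finite_atLeastAtMost] by blast
  obtain hs hs' where "set hs \<subseteq> k_transpositions 1 n" "length hs = a" "x = word_product hs"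
    "set hs' \<subseteq> k_transpositions 1 n" "length hs' = b" "y = word_product hs'"
    using disjoint_swaps_as_word[OF xy(1,3)] disjoint_swaps_as_word[OF xy(2,4)] by blast
  moreover have "word_product (hs @ hs') = word_product hs \<circ> word_product hs'"
    by (induction hs) (auto simp: comp_assoc)
  ultimately show ?thesis using xy(5,6) by (intro exI[of _ "hs @ hs'"]) auto
qed

text \<open>The point of the whole analysis of factorisations: the ball of radius \<open>r\<close> is cut out by the
  length and the parity alone. For \<open>k = 1\<close> the factors of a
  balanced factorisation are simply written out as single transpositions, which works for every radius.\<close>

lemma word_products_eq:
  assumes "k = 1 \<or> even k \<and> 4 * k \<le> n \<and> 2 \<le> r"
  shows "{word_product hs | hs. set hs \<subseteq> k_transpositions k n \<and> length hs \<le> r} =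
    {u. u permutes {1..n} \<and> transposition_length u \<le> r * k \<and> (even k \<longrightarrow> evenperm u)}"
proof (intro equalityI subsetI)
  fix u assume "u \<in> {word_product hs | hs. set hs \<subseteq> k_transpositions k n \<and> length hs \<le> r}"
  then obtain hs where hs: "u = word_product hs" "set hs \<subseteq> k_transpositions k n" "length hs \<le> r"
    by blast
  have "length hs * k \<le> r * k" using hs(3) by (rule mult_le_mono1)
  with word_facts[OF hs(2)] have "word_product hs permutes {1..n}"
    "transposition_length (word_product hs) \<le> r * k" "even k \<longrightarrow> evenperm (word_product hs)"
    by (blast intro: order_trans)+
  with hs(1)
  show "u \<in> {u. u permutes {1..n} \<and> transposition_length u \<le> r * k \<and> (even k \<longrightarrow> evenperm u)}"
    by auto
next
  fix u assume "u \<in> {u. u permutes {1..n} \<and> transposition_length u \<le> r * k \<and> (even k \<longrightarrow> evenperm u)}"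
  then have u: "u permutes {1..n}" "transposition_length u \<le> r * k" "even k \<longrightarrow> evenperm u" by auto
  have "\<exists>hs. set hs \<subseteq> k_transpositions k n \<and> length hs \<le> r \<and> u = word_product hs"
  proof (cases "k = 1")
    case True
    then show ?thesis using perm_as_word_of_transpositions[OF u(1)] u(2) by auto
  next
    case False
    then show ?thesis using assms even_perm_as_word[of k n r u] u by blast
  qed
  then show "u \<in> {word_product hs | hs. set hs \<subseteq> k_transpositions k n \<and> length hs \<le> r}" by blast
qed

lemma (in group) foldr_mult_in_generate:
  "set hs \<subseteq> H \<Longrightarrow> foldr (\<otimes>) hs \<one> \<in> generate G H"
  by (induction hs) (auto intro: generate.one generate.eng generate.incl)

text \<open>The ball around \<open>g\<close> is the left translate by \<open>g\<close> of the ball around the identity, once \<open>g\<close>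
  is known to be a vertex, that is, a product of \<open>k\<close>-transpositions.\<close>

lemma transposition_cayley_graph_ball:
  assumes k: "k = 1 \<or> even k \<and> 4 * k \<le> n \<and> 2 \<le> r"
    and "0 < k"
    and g: "g permutes {1..n}" "even k \<longrightarrow> evenperm g"
  shows "graph_ball (transposition_cayley_graph k n) r g =
    {u. u permutes {1..n} \<and> transposition_length (inv' g \<circ> u) \<le> r * k \<and>
        (even k \<longrightarrow> evenperm (inv' g \<circ> u))}"
proof -
  interpret S: group "sym_group n" by (rule sym_group_is_group)
  let ?H = "k_transpositions k n"
  have H: "?H \<subseteq> carrier (sym_group n)"
    using k_transpositions_facts(1) by (auto simp: sym_group_carrier)
  have fold: "foldr (\<otimes>\<^bsub>sym_group n\<^esub>) hs \<one>\<^bsub>sym_group n\<^esub> = word_product hs" for hs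
    by (simp only: word_product_def sym_group_mult sym_group_one)
  have "\<exists>hs. set hs \<subseteq> ?H \<and> g = word_product hs"
  proof -
    \<comment> \<open>Any radius that is at least 2 and at least the length of \<open>g\<close> will do.\<close>
    let ?r = "max 2 (transposition_length g)"
    have "?r * 1 \<le> ?r * k" using \<open>0 < k\<close> by (intro mult_le_mono2) simp
    then have "transposition_length g \<le> ?r * k" by linarith
    then have "g \<in> {u. u permutes {1..n} \<and> transposition_length u \<le> ?r * k \<and> (even k \<longrightarrow> evenperm u)}"
      using g by blast
    also have "\<dots> = {word_product hs | hs. set hs \<subseteq> ?H \<and> length hs \<le> ?r}"
      using k by (intro word_products_eq[symmetric]) auto
    finally show ?thesis by blast
  qed
  then have gen: "g \<in> generate (sym_group n) ?H"
    using S.foldr_mult_in_generate fold by metis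
  have "graph_ball (transposition_cayley_graph k n) r g =
      {g \<circ> word_product hs | hs. set hs \<subseteq> ?H \<and> length hs \<le> r}"
    unfolding transposition_cayley_graph_def S.graph_ball_cayley_graph[OF H gen] fold
    by (simp only: sym_group_mult)
  also have "\<dots> = (\<lambda>w. g \<circ> w) ` {word_product hs | hs. set hs \<subseteq> ?H \<and> length hs \<le> r}" by blast
  also have "\<dots> = (\<lambda>w. g \<circ> w) `
      {w. w permutes {1..n} \<and> transposition_length w \<le> r * k \<and> (even k \<longrightarrow> evenperm w)}"
    unfolding word_products_eq[OF k] ..
  also have "\<dots> = {u. u permutes {1..n} \<and> transposition_length (inv' g \<circ> u) \<le> r * k \<and>
        (even k \<longrightarrow> evenperm (inv' g \<circ> u))}" (is "_ = ?R")
  proof (intro equalityI subsetI)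
    fix u assume "u \<in> (\<lambda>w. g \<circ> w) `
      {w. w permutes {1..n} \<and> transposition_length w \<le> r * k \<and> (even k \<longrightarrow> evenperm w)}"
    then obtain w where w: "u = g \<circ> w" "w permutes {1..n}" "transposition_length w \<le> r * k"
      "even k \<longrightarrow> evenperm w" by auto
    have "inv' g \<circ> u = w" unfolding w(1) comp_assoc[symmetric] permutes_inv_o(2)[OF g(1)] by (rule id_comp)
    moreover have "u permutes {1..n}" unfolding w(1) by (rule permutes_compose[OF w(2) g(1)])
    ultimately show "u \<in> ?R" using w(3,4) by (auto simp del: comp_apply)
  next
    fix u assume u: "u \<in> ?R"
    have "g \<circ> (inv' g \<circ> u) = u" unfolding comp_assoc[symmetric] permutes_inv_o(1)[OF g(1)] by (rule id_comp)
    moreover have "inv' g \<circ> u permutes {1..n}"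
      using u by (intro permutes_compose[OF _ permutes_inv[OF g(1)]]) auto
    ultimately show "u \<in> (\<lambda>w. g \<circ> w) `
      {w. w permutes {1..n} \<and> transposition_length w \<le> r * k \<and> (even k \<longrightarrow> evenperm w)}"
      using u by (intro image_eqI[of _ _ "inv' g \<circ> u"]) auto
  qed
  finally show ?thesis .
qed

section \<open>The Stirling recurrence for intersections of balls\<close>

text \<open>The parameter is \<open>d = n - m\<close> for the argument \<open>m\<close> of the Stirling function and ranges over all
  integers. The flag \<open>e\<close> is set for even \<open>k\<close>. Its parity condition refers to \<open>d\<close> and
  not simply to even permutations: splitting off the transposition that moves the new point lowers
  \<open>d\<close> by one and changes the parity of the permutation, so this form is preserved by the recurrence. At
  \<open>d = r * k\<close> it selects the even permutations.\<close>

definition ball_intersection :: "bool \<Rightarrow> (nat \<Rightarrow> nat) \<Rightarrow> nat \<Rightarrow> int \<Rightarrow> (nat \<Rightarrow> nat) set" where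
  "ball_intersection e g n d =
     {u. u permutes {1..n} \<and> int (transposition_length u) \<le> d \<and>
         int (transposition_length (inv' g \<circ> u)) \<le> d \<and> (e \<longrightarrow> (evenperm u \<longleftrightarrow> even d))}"

lemma finite_ball_intersection: "finite (ball_intersection e g n d)"
  by (rule finite_subset[of _ "{u. u permutes {1..n}}"])
    (auto simp: ball_intersection_def finite_permutations)

lemma ball_intersection_negative: "d < 0 \<Longrightarrow> ball_intersection e g n d = {}"
  by (auto simp: ball_intersection_def)

lemma metric_intersection_number_eq:
  assumes k: "k = 1 \<or> even k \<and> 4 * k \<le> n \<and> 2 \<le> r"
    and "0 < k"
    and g: "g permutes {1..n}" "evenperm g"
  shows "metric_intersection_number k n r g =
    card (ball_intersection (even k) g n (int r * int k))"
proof -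
  have parity: "evenperm (inv' g \<circ> u) \<longleftrightarrow> evenperm u" if "u permutes {1..n}" for u
  proof -
    have "permutation g" "permutation u"
      using g(1) that by (auto intro: permutes_imp_permutation[OF finite_atLeastAtMost])
    then show ?thesis using g(2) evenperm_comp[of "inv' g" u] evenperm_inv[of g] permutation_inverse[of g] by simp
  qed
  have id_even: "even k \<longrightarrow> evenperm (id :: nat \<Rightarrow> nat)" by simp
  have le: "int a \<le> int r * int k \<longleftrightarrow> a \<le> r * k" for a
    by (metis of_nat_le_iff of_nat_mult)
  have "graph_ball (transposition_cayley_graph k n) r id \<inter> graph_ball (transposition_cayley_graph k n) r g
      = ball_intersection (even k) g n (int r * int k)"
    unfolding transposition_cayley_graph_ball[OF k \<open>0 < k\<close> g(1) impI[OF g(2)]]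
      transposition_cayley_graph_ball[OF k \<open>0 < k\<close> permutes_id id_even]
    unfolding ball_intersection_def le inv_id id_comp
    by (auto simp: parity simp del: comp_apply)
  then show ?thesis by (simp add: metric_intersection_number_def)
qed

text \<open>Let \<open>N = n + 1\<close>, a fixed point of \<open>g\<close>. A permutation of the larger set either fixes \<open>N\<close> or is
  \<open>transpose N b \<circ> u\<close> for unique \<open>b \<le> n\<close> and \<open>u\<close> fixing \<open>N\<close>. In the second case both
  lengths in question grow by exactly one, because \<open>inv g \<circ> transpose N b = transpose N (inv g b) \<circ> inv g\<close>.\<close>

lemma card_ball_intersection_step:
  assumes g: "g permutes {1..n}"
  shows "card (ball_intersection e g (Suc n) d) =
    card (ball_intersection e g n d) + n * card (ball_intersection e g n (d - 1))"
proof -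
  let ?N = "Suc n"
  let ?F = "\<lambda>(b, u). transpose ?N b \<circ> u"
  have gN: "g ?N = ?N" "inv' g ?N = ?N"
    using permutes_not_in[OF g] permutes_not_in[OF permutes_inv[OF g]] by auto
  have pg: "permutation (inv' g)"
    using permutes_inv[OF g] by (rule permutes_imp_permutation[OF finite_atLeastAtMost])
  have ins: "{1..?N} = insert ?N {1..n}" by auto
  have key: "transpose ?N b \<circ> u \<in> ball_intersection e g ?N d \<longleftrightarrow> u \<in> ball_intersection e g n (d - 1)"
    if u: "u permutes {1..n}" and b: "b \<in> {1..n}" for u b
  proof -
    have N: "u ?N = ?N" "b \<noteq> ?N" using permutes_not_in[OF u] b by auto
    have pu: "permutation u" using u by (rule permutes_imp_permutation[OF finite_atLeastAtMost])
    have "transposition_length (transpose ?N b \<circ> u) = Suc (transposition_length u)"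
      using transposition_length_transpose_comp[OF pu N(1)] N(2) by metis
    moreover have "transposition_length (inv' g \<circ> (transpose ?N b \<circ> u)) = Suc (transposition_length (inv' g \<circ> u))"
    proof -
      have b': "inv' g b \<noteq> ?N" using b permutes_in_image[OF permutes_inv[OF g], of b] by auto
      have "inv' g \<circ> (transpose ?N b \<circ> u) = transpose ?N (inv' g b) \<circ> (inv' g \<circ> u)"
      proof
        fix x
        have "inv' g y = inv' g z \<longleftrightarrow> y = z" for y z
          using permutes_inj[OF permutes_inv[OF g]] by (simp add: inj_eq)
        then have "inv' g (u x) = ?N \<longleftrightarrow> u x = ?N" "inv' g (u x) = inv' g b \<longleftrightarrow> u x = b"
          using gN(2) by metis+
        then show "(inv' g \<circ> (transpose ?N b \<circ> u)) x = (transpose ?N (inv' g b) \<circ> (inv' g \<circ> u)) x"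
          using gN(2) by (auto simp: transpose_def)
      qed
      then show ?thesis
        using transposition_length_transpose_comp[OF permutation_compose[OF pg pu], of ?N "inv' g b"] N(1) gN(2) b'
        by simp
    qed
    moreover have "evenperm (transpose ?N b \<circ> u) \<longleftrightarrow> \<not> evenperm u"
      using evenperm_comp[OF permutation_swap_id pu] evenperm_swap[of ?N b] N(2) by metis
    moreover have "transpose ?N b \<circ> u permutes {1..?N}"
      using b by (intro permutes_compose[OF permutes_subset[OF u]] permutes_swap_id) auto
    ultimately show ?thesis
      using u by (auto simp: ball_intersection_def simp del: comp_apply)
  qed
  have key0: "u \<in> ball_intersection e g ?N d \<longleftrightarrow> u \<in> ball_intersection e g n d"
    if "u permutes {1..n}" for u
    using that permutes_subset[OF that, of "{1..?N}"] by (auto simp: ball_intersection_def)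
  have split: "ball_intersection e g ?N d =
      ball_intersection e g n d \<union> ?F ` ({1..n} \<times> ball_intersection e g n (d - 1))" (is "?L = ?R")
  proof (intro equalityI subsetI)
    fix w assume w: "w \<in> ?L"
    then have "w \<in> {p. p permutes insert ?N {1..n}}" using ins by (simp add: ball_intersection_def)
    then obtain b u where bu: "w = transpose ?N b \<circ> u" "b \<in> insert ?N {1..n}" "u permutes {1..n}"
      unfolding permutes_insert by auto
    show "w \<in> ?R"
    proof (cases "b = ?N")
      case True
      then have "w = u" using bu(1) by simp
      then show ?thesis using w key0[OF bu(3)] by simp
    next
      case False
      then have b: "b \<in> {1..n}" using bu(2) by simp
      then have "u \<in> ball_intersection e g n (d - 1)" using w key[OF bu(3)] bu(1) by metis
      with b have "?F (b, u) \<in> ?F ` ({1..n} \<times> ball_intersection e g n (d - 1))" by blast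
      then show ?thesis using bu(1) by simp
    qed
  next
    fix w assume "w \<in> ?R"
    then show "w \<in> ?L"
    proof
      assume "w \<in> ball_intersection e g n d"
      moreover from this have "w permutes {1..n}" by (simp add: ball_intersection_def)
      ultimately show ?thesis using key0 by simp
    next
      assume "w \<in> ?F ` ({1..n} \<times> ball_intersection e g n (d - 1))"
      then obtain b u where bu: "w = transpose ?N b \<circ> u" "b \<in> {1..n}" "u \<in> ball_intersection e g n (d - 1)"
        by auto
      then have "u permutes {1..n}" by (simp add: ball_intersection_def)
      then show ?thesis using key[OF _ bu(2)] bu by metis
    qed
  qed
  have at_N: "?F (b, u) ?N = b" if "u \<in> ball_intersection e g n d'" for b u d'
  proof -
    have "u ?N = ?N" using that by (intro permutes_not_in[of u "{1..n}"]) (auto simp: ball_intersection_def)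
    then show ?thesis by simp
  qed
  have inj: "inj_on ?F ({1..n} \<times> ball_intersection e g n (d - 1))"
  proof (rule inj_onI)
    fix x y assume xy: "x \<in> {1..n} \<times> ball_intersection e g n (d - 1)"
      "y \<in> {1..n} \<times> ball_intersection e g n (d - 1)" "?F x = ?F y"
    obtain b u c v where x: "x = (b, u)" and y: "y = (c, v)" by (cases x, cases y) auto
    have "b = ?F x ?N" "c = ?F y ?N"
      using at_N[of u "d - 1" b] at_N[of v "d - 1" c] xy(1,2) unfolding x y by auto
    then have "b = c" unfolding xy(3) by simp
    moreover have "transpose ?N c \<circ> (transpose ?N c \<circ> u) = transpose ?N c \<circ> (transpose ?N c \<circ> v)"
      using xy(3) x y \<open>b = c\<close> by (simp del: comp_apply)
    then have "u = v" by (simp add: comp_assoc[symmetric])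
    ultimately show "x = y" using x y by simp
  qed
  have "?F (b, u) \<notin> ball_intersection e g n d" if "b \<in> {1..n}" "u \<in> ball_intersection e g n (d - 1)" for b u
  proof
    assume "?F (b, u) \<in> ball_intersection e g n d"
    then have "?F (b, u) permutes {1..n}" by (simp add: ball_intersection_def)
    then have "?F (b, u) ?N = ?N" by (rule permutes_not_in) simp
    then show False using at_N[OF that(2), of b] that(1) by simp
  qed
  then have "ball_intersection e g n d \<inter> ?F ` ({1..n} \<times> ball_intersection e g n (d - 1)) = {}"
    by fastforce
  then have "card ?L = card (ball_intersection e g n d) +
      card (?F ` ({1..n} \<times> ball_intersection e g n (d - 1)))"
    unfolding split using finite_ball_intersection by (intro card_Un_disjoint) auto
  then show ?thesis unfolding card_image[OF inj] card_cartesian_product by simp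
qed

lemma card_ball_intersection_conj:
  assumes s: "s permutes {1..n}" and g: "g permutes {1..n}"
  shows "card (ball_intersection e (s \<circ> g \<circ> inv' s) n d) = card (ball_intersection e g n d)"
proof -
  have sub: "card (ball_intersection e g n d) \<le> card (ball_intersection e (s \<circ> g \<circ> inv' s) n d)"
    if s: "s permutes {1..n}" and g: "g permutes {1..n}" for s g
  proof (rule card_inj_on_le[of "\<lambda>u. s \<circ> u \<circ> inv' s"])
    have bij: "bij s" using s by (rule permutes_bij)
    show "inj_on (\<lambda>u. s \<circ> u \<circ> inv' s) (ball_intersection e g n d)"
      by (rule inj_on_inverseI[where g = "\<lambda>u. inv' s \<circ> u \<circ> inv' (inv' s)"]) (rule conj_conj_inv[OF bij])
    show "(\<lambda>u. s \<circ> u \<circ> inv' s) ` ball_intersection e g n d \<subseteq> ball_intersection e (s \<circ> g \<circ> inv' s) n d"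
    proof (rule image_subsetI)
      fix u assume u: "u \<in> ball_intersection e g n d"
      then have up: "u permutes {1..n}" by (simp add: ball_intersection_def)
      have "inv' (s \<circ> g \<circ> inv' s) \<circ> (s \<circ> u \<circ> inv' s) = s \<circ> (inv' g \<circ> u) \<circ> inv' s"
      proof -
        have "inv' (s \<circ> g \<circ> inv' s) = s \<circ> inv' g \<circ> inv' s"
          using bij permutes_bij[OF g] by (simp add: o_inv_distrib bij_comp bij_imp_bij_inv inv_inv_eq comp_assoc)
        then show ?thesis using permutes_inverses(2)[OF s] by (simp add: fun_eq_iff)
      qed
      moreover have "s \<circ> u \<circ> inv' s permutes {1..n}"
        using permutes_compose[OF permutes_inv[OF s] permutes_compose[OF up s]] by (simp only: comp_assoc)
      moreover have "evenperm (s \<circ> u \<circ> inv' s) \<longleftrightarrow> evenperm u"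
        using s up by (intro evenperm_conj permutes_imp_permutation[OF finite_atLeastAtMost])
      ultimately show "s \<circ> u \<circ> inv' s \<in> ball_intersection e (s \<circ> g \<circ> inv' s) n d"
        using u transposition_length_conj[OF bij] unfolding ball_intersection_def mem_Collect_eq by metis
    qed
  qed (rule finite_ball_intersection)
  have "card (ball_intersection e (s \<circ> g \<circ> inv' s) n d) \<le>
      card (ball_intersection e (inv' s \<circ> (s \<circ> g \<circ> inv' s) \<circ> inv' (inv' s)) n d)"
    by (rule sub[OF permutes_inv[OF s]])
      (use permutes_compose[OF permutes_inv[OF s] permutes_compose[OF g s]] in \<open>simp only: comp_assoc\<close>)
  also have "\<dots> = card (ball_intersection e g n d)"
    by (simp only: conj_conj_inv[OF permutes_bij[OF s]])
  finally show ?thesis using sub[OF s g] by simp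
qed

section \<open>Copies of a permutation in different symmetric groups\<close>

lemma evenperm_map_permutation:
  assumes "p permutes B" "finite B" "inj_on f B"
  shows "evenperm (map_permutation B f p) \<longleftrightarrow> evenperm p"
  using assms(1,2)
proof (induction rule: permutes_induct)
  case id
  show "evenperm (map_permutation B f id) \<longleftrightarrow> evenperm id"
    by (simp add: map_permutation_id'[OF assms(3)])
next
  case (swap a b p)
  have "map_permutation B f (transpose a b \<circ> p) = map_permutation B f (transpose a b) \<circ> map_permutation B f p"
    by (rule map_permutation_compose'[OF assms(3) swap.hyps(4)])
  also have "map_permutation B f (transpose a b) = transpose (f a) (f b)"
    by (intro map_permutation_transpose[OF assms(3)] swap.hyps)
  finally have eq: "map_permutation B f (transpose a b \<circ> p) = transpose (f a) (f b) \<circ> map_permutation B f p" .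
  have "map_permutation B f p permutes f ` B"
    by (intro map_permutation_permutes[OF _ swap.hyps(4)]) (simp add: assms(3) bij_betw_def)
  then have "permutation (map_permutation B f p)" "permutation p"
    using assms(2) swap.hyps(4) by (auto intro: permutes_imp_permutation)
  moreover have "f a \<noteq> f b" using swap.hyps assms(3) by (auto dest: inj_onD)
  ultimately show "evenperm (map_permutation B f (transpose a b \<circ> p)) \<longleftrightarrow> evenperm (transpose a b \<circ> p)"
    unfolding eq using swap.IH swap.hyps(3)
    by (simp add: evenperm_comp permutation_swap_id evenperm_swap del: comp_apply)
qed

text \<open>Any bijection between the two embedded sets extends to a permutation of \<open>{1..n}\<close>, as their
  complements have the same size; that permutation conjugates one copy to the other.\<close>

lemma map_permutation_conjugate:
  assumes p: "p permutes B" and B: "finite B" and f: "inj_on f B" "f ` B \<subseteq> {1..n::nat}"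
    and f': "inj_on f' B" "f' ` B \<subseteq> {1..n}"
  shows "\<exists>s. s permutes {1..n} \<and> map_permutation B f' p = s \<circ> map_permutation B f p \<circ> inv' s"
proof -
  have "card ({1..n} - f ` B) = card ({1..n} - f' ` B)"
    using B f f' by (simp add: card_Diff_subset card_image)
  then obtain h where h: "bij_betw h ({1..n} - f ` B) ({1..n} - f' ` B)"
    using finite_same_card_bij by (metis finite_Diff finite_atLeastAtMost)
  \<comment> \<open>\<open>s\<close> sends \<open>f b\<close> to \<open>f' b\<close> and matches the complements by \<open>h\<close>.\<close>
  define s where "s x = (if x \<in> f ` B then f' (inv_into B f x) else if x \<in> {1..n} then h x else x)" for x
  have s_f: "s (f b) = f' b" if "b \<in> B" for b using that f(1) by (simp add: s_def)
  have "bij_betw s (f ` B) (f' ` B)"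
  proof (rule bij_betw_imageI)
    show "inj_on s (f ` B)" using f'(1) by (auto simp: inj_on_def s_f)
    show "s ` f ` B = f' ` B" using s_f by (auto simp: image_image)
  qed
  moreover have "bij_betw s ({1..n} - f ` B) ({1..n} - f' ` B)"
    using h by (rule bij_betw_cong[THEN iffD1, rotated]) (auto simp: s_def)
  ultimately have "bij_betw s (f ` B \<union> ({1..n} - f ` B)) (f' ` B \<union> ({1..n} - f' ` B))"
    by (rule bij_betw_combine) auto
  then have "bij_betw s {1..n} {1..n}" using f(2) f'(2) by (simp add: Un_absorb1)
  then have s: "s permutes {1..n}"
    by (rule bij_imp_permutes) (use f(2) in \<open>auto simp: s_def\<close>)
  have "map_permutation B f' p (s y) = s (map_permutation B f p y)" for y
  proof (cases "y \<in> f ` B")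
    case True
    then obtain b where b: "b \<in> B" "y = f b" by blast
    then have "p b \<in> B" using permutes_in_image[OF p] by simp
    then show ?thesis using b f f' p by (simp add: s_f map_permutation_apply)
  next
    case False
    have "s y \<notin> f' ` B"
    proof
      assume "s y \<in> f' ` B"
      then obtain b where "b \<in> B" "s y = s (f b)" using s_f by auto
      then have "y = f b" using permutes_inj[OF s] by (simp add: inj_eq)
      with \<open>b \<in> B\<close> False show False by blast
    qed
    then show ?thesis using False by (simp add: map_permutation_def)
  qed
  then have "map_permutation B f' p (s (inv' s y)) = s (map_permutation B f p (inv' s y))" for y .
  then have "map_permutation B f' p = s \<circ> map_permutation B f p \<circ> inv' s"
    using permutes_inverses(1)[OF s] by (simp add: fun_eq_iff)
  with s show ?thesis by blast
qed

lemma permutes_moved: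
  assumes "g permutes A"
  shows "g permutes (moved g)"
proof -
  have "\<forall>x. x \<notin> moved g \<longrightarrow> g x = x" by (simp add: moved_def)
  then show ?thesis using assms unfolding permutes_def by blast
qed

theorem theorem1:
  fixes k s t :: nat and A :: "'a set" and g :: "'a \<Rightarrow> 'a"
  assumes "(k \<ge> 2 \<and> even k) \<or> k = 1"
    and "finite A" and "g permutes A" and "evenperm g"
    and "s = card (moved g)"
    and "t = max s (4 * k)"
  shows "\<exists>S. stirling_function t S \<and>
           (\<forall>n>t. \<forall>r. r \<ge> 3 \<or> k = 1 \<longrightarrow>
              (\<forall>g' \<in> copies_in_Sym n g.
                 metric_intersection_number k n r g' = S n (int n - int r * int k)))"
proof -
  let ?B = "moved g"
  have gB: "g permutes ?B" by (rule permutes_moved[OF assms(3)])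
  have "?B \<subseteq> A" using assms(3) by (auto simp: moved_def permutes_def)
  then have B: "finite ?B" using assms(2) by (rule finite_subset)
  obtain f where f: "bij_betw f ?B {1..s}"
    using finite_same_card_bij[OF B finite_atLeastAtMost, of 1 s] assms(5) by auto
  \<comment> \<open>A fixed copy on \<open>{1..s}\<close> serves all \<open>n \<ge> s\<close> at once, so that the recurrence can compare \<open>n\<close> with
    \<open>n - 1\<close>.\<close>
  define g0 where "g0 = map_permutation ?B f g"
  have g0: "g0 permutes {1..s}" unfolding g0_def by (rule map_permutation_permutes[OF f gB])
  have g0n: "g0 permutes {1..n}" if "s \<le> n" for n
    by (rule permutes_subset[OF g0]) (use that in auto)
  define S where "S n m = card (ball_intersection (even k) g0 n (int n - m))" for n m
  have "stirling_function t S"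
    unfolding stirling_function_def
  proof (intro conjI allI impI)
    fix n m assume "t < n"
    then obtain n' where n: "n = Suc n'" "s \<le> n'" using assms(6) by (cases n) auto
    have d: "int n' - (m - 1) = int (Suc n') - m" "int n' - m = int (Suc n') - m - 1" by simp_all
    show "S n m = S (n - 1) (m - 1) + (n - 1) * S (n - 1) m"
      using card_ball_intersection_step[OF g0n[OF n(2)], of "even k" "int (Suc n') - m"]
      unfolding S_def n(1) diff_Suc_1 d .
  next
    fix n m assume "int n < m"
    then show "S n m = 0" by (simp add: S_def ball_intersection_negative)
  qed
  moreover have "metric_intersection_number k n r g' = S n (int n - int r * int k)"
    if n: "t < n" and r: "r \<ge> 3 \<or> k = 1" and g': "g' \<in> copies_in_Sym n g" for n r g'
  proof -
    obtain f' where f': "g' = map_permutation ?B f' g" "inj_on f' ?B" "f' ` ?B \<subseteq> {1..n}"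
      using g' unfolding copies_in_Sym_def by blast
    have sn: "s \<le> n" "4 * k \<le> n" using n assms(6) by auto
    have fn: "inj_on f ?B" "f ` ?B \<subseteq> {1..n}" using f sn(1) by (auto simp: bij_betw_def)
    obtain \<sigma> where \<sigma>: "\<sigma> permutes {1..n}" "g' = \<sigma> \<circ> g0 \<circ> inv' \<sigma>"
      using map_permutation_conjugate[OF gB B fn f'(2,3)] unfolding f'(1) g0_def by blast
    have "g' permutes f' ` ?B"
      unfolding f'(1) using f'(2) by (intro map_permutation_permutes[OF _ gB]) (simp add: bij_betw_def)
    then have g'n: "g' permutes {1..n}" using f'(3) by (rule permutes_subset)
    have "evenperm g'" unfolding f'(1) using evenperm_map_permutation[OF gB B f'(2)] assms(4) by simp
    moreover have "0 < k" using assms(1) by auto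
    moreover have "k = 1 \<or> even k \<and> 4 * k \<le> n \<and> 2 \<le> r" using assms(1) r sn(2) by auto
    ultimately have "metric_intersection_number k n r g' =
        card (ball_intersection (even k) g' n (int r * int k))"
      using g'n by (intro metric_intersection_number_eq)
    also have "\<dots> = card (ball_intersection (even k) g0 n (int r * int k))"
      unfolding \<sigma>(2) by (rule card_ball_intersection_conj[OF \<sigma>(1) g0n[OF sn(1)]])
    finally show ?thesis by (simp add: S_def)
  qed
  ultimately show ?thesis by blast
qed

end
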